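(* Let $(C_n)_{n\geq 0}$ be the sequence of Catalan numbers. Then the Catalan number generating function, i.e. the power series $$C(x) := C_0 + C_1 x + C_2 x^2 + \cdots + C_n x^n + \cdots,$$ has a positive radius of convergence, and this radius of convergence is at least equal to $\frac{1}{6}$.
   Context: The Catalan number $C_n$ is the number of ways in which a convex polygon with $n+2$ sides can be partitioned into triangles by diagonals which do not intersect within the polygon, with $C_0 = 1$. Equivalently, the Catalan numbers are the sequence determined by $C_0 = 1$ and Segner's recursion formula $$C_{n+1} = C_0 C_n + C_1 C_{n-1} + C_2 C_{n-2} + \cdots + C_{n-1} C_1 + C_n C_0 \qquad (n \geq 0);$$ they are also given by $C_n = \frac{1}{n+1}\binom{2n}{n}$. *)

theory Defs
  imports "HOL-Analysis.Analysis"
begin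

fun catalan :: "nat \<Rightarrow> nat" where
  "catalan 0 = 1"
| "catalan (Suc n) = (\<Sum>k\<le>n. catalan k * catalan (n - k))"

lemma "map catalan [0..<7] = [1, 1, 2, 5, 14, 42, 132]"
  by code_simp

definition catalan_fps :: "'a::semiring_1 fps" where
  "catalan_fps = Abs_fps (\<lambda>n. of_nat (catalan n))"

end

theory Submission
  imports Defs
begin

text \<open>
  Read at the level of generating functions, Segner's recursion is the functional equation
  \<open>C(x) = 1 + x C(x)\<^sup>2\<close>.  For a partial sum \<open>S\<^sub>N(x)\<close> of \<open>C(x)\<close> and \<open>x \<ge> 0\<close> it degrades
  to the inequality \<open>S\<^sub>N\<^sub>+\<^sub>1(x) \<le> 1 + x S\<^sub>N(x)\<^sup>2\<close>, because every product occurring on the left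
  also occurs when the square on the right is expanded.  At \<open>x = 1/4\<close> the map \<open>s \<mapsto> 1 + x s\<^sup>2\<close> has
  the fixed point \<open>2\<close> and is increasing on \<open>[0, 2]\<close>, so induction keeps all partial sums in that
  interval (\<open>catalan_partial_sum_le_2\<close>).  A nonnegative series with bounded partial sums
  converges; hence the power series converges absolutely at \<open>1/4\<close>.  This gives a radius
  of convergence of at least \<open>1/4\<close>, which exceeds the required \<open>1/6\<close>.
\<close>

text \<open>
  The pairs \<open>(i, j)\<close> with \<open>i + j \<le> N\<close>, over which the convolutions range, form a triangle
  inside the square \<open>{..N} \<times> {..N}\<close>, over which the square of the partial sum ranges.
\<close>
lemma sum_convolution_le_square:
  fixes a :: "nat \<Rightarrow> 'b::linordered_idom"
  assumes "\<And>n. 0 \<le> a n"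
  shows "(\<Sum>n\<le>N. \<Sum>k\<le>n. a k * a (n - k)) \<le> (\<Sum>n\<le>N. a n)\<^sup>2"
proof -
  have "(\<Sum>n\<le>N. \<Sum>k\<le>n. a k * a (n - k)) = (\<Sum>(i, j)\<in>{(i, j). i + j \<le> N}. a i * a j)"
    by (rule sum.triangle_reindex_eq [symmetric])
  also have "\<dots> \<le> (\<Sum>(i, j)\<in>{..N} \<times> {..N}. a i * a j)"
    by (rule sum_mono2) (auto simp: assms)
  also have "\<dots> = (\<Sum>n\<le>N. a n)\<^sup>2"
    by (simp add: power2_eq_square sum_product sum.cartesian_product)
  finally show ?thesis .
qed

lemma catalan_partial_sum_Suc_le:
  fixes x :: real
  assumes "0 \<le> x"
  shows "(\<Sum>n\<le>Suc N. real (catalan n) * x ^ n) \<le> 1 + x * (\<Sum>n\<le>N. real (catalan n) * x ^ n)\<^sup>2"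
proof -
  define a where "a n = real (catalan n) * x ^ n" for n
  have segner: "a (Suc n) = x * (\<Sum>k\<le>n. a k * a (n - k))" for n
  proof -
    have "real (catalan k * catalan (n - k)) * x ^ Suc n = x * (a k * a (n - k))" if "k \<le> n" for k
    proof -
      have "x ^ Suc n = x * (x ^ k * x ^ (n - k))"
        using that by (simp flip: power_add)
      then show ?thesis
        by (simp add: a_def mult_ac del: power_Suc)
    qed
    then show ?thesis
      by (simp add: a_def [of "Suc n"] sum_distrib_left sum_distrib_right del: power_Suc of_nat_mult)
  qed
  have "(\<Sum>n\<le>Suc N. a n) = 1 + x * (\<Sum>n\<le>N. \<Sum>k\<le>n. a k * a (n - k))"
    by (subst sum.atMost_Suc_shift) (simp add: segner sum_distrib_left, simp add: a_def)
  also have "\<dots> \<le> 1 + x * (\<Sum>n\<le>N. a n)\<^sup>2"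
    using assms by (intro add_left_mono mult_left_mono sum_convolution_le_square) (simp_all add: a_def)
  finally show ?thesis
    by (simp only: a_def)
qed

lemma catalan_partial_sum_le_2: "(\<Sum>n\<le>N. real (catalan n) * (1 / 4) ^ n) \<le> 2"
proof (induction N)
  case 0
  show ?case by simp
next
  case (Suc N)
  let ?S = "\<Sum>n\<le>N. real (catalan n) * (1 / 4) ^ n"
  have "(\<Sum>n\<le>Suc N. real (catalan n) * (1 / 4) ^ n) \<le> 1 + 1 / 4 * ?S\<^sup>2"
    by (rule catalan_partial_sum_Suc_le) simp
  also have "?S\<^sup>2 \<le> 2\<^sup>2"
    using Suc.IH by (intro power_mono sum_nonneg) simp_all
  finally show ?case
    by simp
qed

lemma summable_catalan: "summable (\<lambda>n. real (catalan n) * (1 / 4) ^ n)"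
proof (rule summableI_nonneg_bounded)
  show "(\<Sum>n<N. real (catalan n) * (1 / 4) ^ n) \<le> 2" for N
  proof -
    have "(\<Sum>n<N. real (catalan n) * (1 / 4) ^ n) \<le> (\<Sum>n\<le>N. real (catalan n) * (1 / 4) ^ n)"
      by (rule sum_mono2) auto
    then show ?thesis
      using catalan_partial_sum_le_2 [of N] by linarith
  qed
qed simp

text \<open>
  The norm of a real normed division algebra is multiplicative and agrees with the absolute value
  on the embedded reals, so evaluating at \<open>of_real (1 / 4)\<close> turns the real convergence statement
  into absolute convergence in \<open>'a\<close>.
\<close>
lemma fps_conv_radius_catalan_ge:
  "fps_conv_radius (catalan_fps :: 'a::{banach, real_normed_div_algebra} fps) \<ge> ereal (1 / 4)"
proof -
  let ?z = "of_real (1 / 4) :: 'a"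
  have norm_z: "norm ?z = 1 / 4"
    by (simp only: norm_of_real)
  have "norm (of_nat (catalan n) * ?z ^ n) = real (catalan n) * (1 / 4) ^ n" for n
    by (simp only: norm_mult norm_power norm_z norm_of_nat)
  then have "summable (\<lambda>n. norm (of_nat (catalan n) * ?z ^ n))"
    using summable_catalan by simp
  then have "summable (\<lambda>n. of_nat (catalan n) * ?z ^ n)"
    by (rule summable_norm_cancel)
  then have "conv_radius (\<lambda>n. of_nat (catalan n) :: 'a) \<ge> norm ?z"
    by (rule conv_radius_geI)
  then show ?thesis
    unfolding norm_z
    by (simp add: fps_conv_radius_def catalan_fps_def)
qed

theorem theorem2:
  shows "fps_conv_radius (catalan_fps :: 'a::{banach, real_normed_div_algebra} fps) > 0
       \<and> fps_conv_radius (catalan_fps :: 'a fps) \<ge> ereal (1 / 6)"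
proof -
  have "ereal (1 / 6) \<le> ereal (1 / 4)" and "0 < ereal (1 / 4)"
    by simp_all
  then show ?thesis
    using fps_conv_radius_catalan_ge [where ?'a = 'a] by (meson less_le_trans order_trans)
qed

end
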